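(* Let $r\in(0,+\infty)$ and let $b>a>0$ be real numbers. Then $$C_r(a,b)+C_{-r}(a,b)>a+b,$$ where $C_r(a,b)$ denotes the generalized inverse harmonic mean of $a$ and $b$.
   Context: For positive real numbers $a,b$ and real $r\neq 1$, the generalized inverse harmonic mean is $$C_r(a,b)=\Big(\frac{b^r+a^r}{b+a}\Big)^{\frac{1}{r-1}},$$ and $C_1(a,b)$ is defined as the limit as $r\to 1$: $C_1(a,b)=\big(b^b a^a\big)^{\frac{1}{a+b}}$. *)

theory Defs
  imports Complex_Main
begin

definition inv_harmonic_mean :: "real \<Rightarrow> real \<Rightarrow> real \<Rightarrow> real" where
  "inv_harmonic_mean r a b =
     (if r = 1 then (b powr b * a powr a) powr (1 / (a + b))
      else ((b powr r + a powr r) / (b + a)) powr (1 / (r - 1)))"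

text \<open>The value at \<open>r = 1\<close> is the limit of the values for \<open>r \<noteq> 1\<close>.\<close>

lemma inv_harmonic_mean_tendsto_1:
  fixes a b :: real
  assumes "a > 0" and "b > 0"
  shows "((\<lambda>r. inv_harmonic_mean r a b) \<longlongrightarrow> inv_harmonic_mean 1 a b) (at 1)"
proof -
  define g where "g = (\<lambda>r. ln (b powr r + a powr r) - ln (b + a))"
  have pos: "b powr r + a powr r > 0" "b + a > 0" for r
    using assms by (simp_all add: add_pos_pos)
  have g: "g r = ln ((b powr r + a powr r) / (b + a))" for r
    using pos(1)[of r] pos(2) by (simp add: g_def ln_div)
  have g1: "g 1 = 0"
    using assms by (simp add: g_def)
  have "(g has_real_derivative (b * ln b + a * ln a) / (b + a)) (at 1)"
    unfolding g_def using assms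
    by (auto intro!: derivative_eq_intros simp: add_pos_pos)
  then have "((\<lambda>r. (g r - g 1) / (r - 1)) \<longlongrightarrow> (b * ln b + a * ln a) / (b + a)) (at 1)"
    by (simp add: has_field_derivative_iff)
  then have lim: "((\<lambda>r. exp ((g r - g 1) / (r - 1))) \<longlongrightarrow> exp ((b * ln b + a * ln a) / (b + a))) (at 1)"
    by (rule tendsto_exp)
  have eq: "exp ((g r - g 1) / (r - 1)) = inv_harmonic_mean r a b" if "r \<noteq> 1" for r
    using that pos(1)[of r] pos(2) g1 g[of r]
    by (simp add: inv_harmonic_mean_def powr_def[of "(b powr r + a powr r) / (b + a)"])
  have val: "exp ((b * ln b + a * ln a) / (b + a)) = inv_harmonic_mean 1 a b"
    using assms by (simp add: inv_harmonic_mean_def powr_def add.commute flip: exp_add)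
  have "\<forall>\<^sub>F r in at 1. exp ((g r - g 1) / (r - 1)) = inv_harmonic_mean r a b"
    using eq by (auto simp: eventually_at_filter)
  from Lim_transform_eventually[OF lim this] show ?thesis
    by (simp add: val)
qed

end

theory Submission imports Defs "HOL-Real_Asymp.Real_Asymp" begin

text \<open>
  Write \<open>a = exp (m - t)\<close> and \<open>b = exp (m + t)\<close>. For \<open>r \<noteq> 1\<close> the two means are
  \<open>exp m * exp (w \<plusminus> r * w)\<close> with \<open>w = (ln (cosh (r t)) - ln (cosh t)) / (r\<^sup>2 - 1)\<close>, so the
  claim says that \<open>g t = w + ln (cosh (r w)) - ln (cosh t)\<close> is positive. Now \<open>g\<close> tends to 0 both
  as \<open>t \<rightarrow> 0\<close> and as \<open>t \<rightarrow> \<infinity>\<close>, so it suffices that \<open>g\<close> first increases and then decreases. The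
  derivative of \<open>g\<close> has the same sign as a function \<open>h\<close> that vanishes at 0 and whose own
  derivative has the sign of the strictly decreasing function
  \<open>(r - 1) * (r * cosh t - cosh (r t))\<close>; hence \<open>h\<close>, and with it the derivative of \<open>g\<close>, stays
  negative once it is nonpositive. The case \<open>r = 1\<close> follows the same pattern with
  \<open>g t = t * tanh t - ln (2 * cosh t - 1)\<close>.
\<close>

section \<open>Propagating one-way sign changes from a derivative to its antiderivative\<close>

definition neg_persists :: "(real \<Rightarrow> real) \<Rightarrow> bool" where
  "neg_persists f \<longleftrightarrow> (\<forall>t>0. \<forall>u>t. f t \<le> 0 \<longrightarrow> f u < 0)"

lemma neg_persistsD: "neg_persists f \<Longrightarrow> 0 < t \<Longrightarrow> t < u \<Longrightarrow> f t \<le> 0 \<Longrightarrow> f u < 0"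
  by (auto simp: neg_persists_def)

text \<open>If \<open>f'\<close> were positive on all of \<open>(0, t)\<close>, then
  \<open>f\<close> would increase from its limit 0 and \<open>f t\<close> would be positive. So
  \<open>f'\<close> is nonpositive somewhere before \<open>t\<close>, hence negative from there on,
  and the mean value theorem applies beyond \<open>t\<close>.\<close>

lemma strict_decreasing_from_nonpos:
  fixes f f' :: "real \<Rightarrow> real"
  assumes deriv: "\<And>t. t > 0 \<Longrightarrow> (f has_real_derivative f' t) (at t)"
    and lim: "(f \<longlongrightarrow> 0) (at_right 0)"
    and neg: "neg_persists f'"
    and "0 < t" "f t \<le> 0" "t \<le> v" "v < u"
  shows "f u < f v"
proof -
  have "\<exists>x. 0 < x \<and> x < t \<and> f' x \<le> 0"
  proof (rule ccontr)
    assume "\<not> ?thesis"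
    then have pos: "f' x > 0" if "0 < x" "x < t" for x
      using that by force
    have less: "f x < f y" if "0 < x" "x < y" "y \<le> t" for x y
    proof -
      have "\<exists>z>x. z < y \<and> f y - f x = (y - x) * f' z"
        by (rule MVT2[OF \<open>x < y\<close>]) (use deriv that in auto)
      then obtain z where "z > x" "z < y" "f y - f x = (y - x) * f' z"
        by blast
      then show ?thesis
        using pos[of z] that by (smt (verit) mult_pos_pos)
    qed
    have "eventually (\<lambda>x. f x \<le> f (t/2)) (at_right 0)"
      unfolding eventually_at_right_field
      using \<open>0 < t\<close> less[of _ "t/2"] by (intro exI[of _ "t/2"]) (auto simp: less_imp_le)
    then have "0 \<le> f (t/2)"
      using lim by (intro tendsto_upperbound[OF lim]) auto
    then show False
      using less[of "t/2" t] assms by auto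
  qed
  then obtain x where x: "0 < x" "x < t" "f' x \<le> 0" by blast
  have "\<exists>z>v. z < u \<and> f u - f v = (u - v) * f' z"
    by (rule MVT2[OF \<open>v < u\<close>]) (use deriv assms in auto)
  then obtain z where z: "z > v" "z < u" "f u - f v = (u - v) * f' z"
    by blast
  have "f' z < 0"
    using neg_persistsD[OF neg x(1) _ x(3), of z] z x assms by auto
  then have "(u - v) * f' z < 0"
    using assms by (simp add: mult_pos_neg)
  then show ?thesis
    using z(3) by linarith
qed

lemma neg_persists_antiderivative:
  fixes f f' :: "real \<Rightarrow> real"
  assumes "\<And>t. t > 0 \<Longrightarrow> (f has_real_derivative f' t) (at t)"
    and "(f \<longlongrightarrow> 0) (at_right 0)"
    and "neg_persists f'"
  shows "neg_persists f"
  unfolding neg_persists_def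
proof (intro allI impI)
  fix t u assume "0 < t" "t < u" "f t \<le> 0"
  then have "f u < f t"
    using strict_decreasing_from_nonpos[OF assms, of t t u] by auto
  then show "f u < 0"
    using \<open>f t \<le> 0\<close> by linarith
qed

text \<open>A nonpositive value at \<open>t\<close> would force strict decrease afterwards, keeping
  \<open>f\<close> below the negative number \<open>f (t + 1)\<close> and away from its limit
  0.\<close>

lemma pos_if_limits_zero:
  fixes f f' :: "real \<Rightarrow> real"
  assumes "\<And>t. t > 0 \<Longrightarrow> (f has_real_derivative f' t) (at t)"
    and "(f \<longlongrightarrow> 0) (at_right 0)"
    and "neg_persists f'"
    and lim: "(f \<longlongrightarrow> 0) at_top"
    and "0 < t"
  shows "0 < f t"
proof (rule ccontr)
  assume "\<not> 0 < f t"
  then have t: "f t \<le> 0" by simp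
  note less = strict_decreasing_from_nonpos[OF assms(1-3) \<open>0 < t\<close> t, simplified]
  have "eventually (\<lambda>u. f u \<le> f (t + 1)) at_top"
    using eventually_gt_at_top[of "t + 1"] by eventually_elim (auto intro!: less_imp_le less)
  then have "0 \<le> f (t + 1)"
    by (intro tendsto_upperbound[OF lim]) auto
  then show False
    using less[of t "t + 1"] t by auto
qed

lemma sinh_mult_sign:
  fixes r t :: real
  assumes "r \<noteq> 0" "t > 0"
  shows "sinh (r * t) / r > 0"
  using assms by (cases "r > 0") (auto simp: zero_less_divide_iff mult_neg_pos)

section \<open>The hyperbolic inequality for r = 1\<close>

lemma two_cosh_minus_1_less:
  fixes t :: real
  assumes "t > 0"
  shows "2 * cosh t - 1 < exp (t * tanh t)"
proof -
  define f where "f = (\<lambda>t::real. t * tanh t - ln (2 * cosh t - 1))"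
  \<comment> \<open>Multiplying the derivative of \<open>f\<close> by \<open>cosh t ^ 2\<close>
    leaves \<open>t\<close> with coefficient 1, so one more differentiation gives a rational
    function of \<open>cosh t\<close> alone.\<close>
  define h where "h = (\<lambda>t::real. t - sinh t * cosh t / (2 * cosh t - 1))"
  define f' where "f' = (\<lambda>t. h t / cosh t ^ 2)"
  define h' where "h' = (\<lambda>t::real. 2 * cosh t * (cosh t - 1) * (2 - cosh t) / (2 * cosh t - 1) ^ 2)"
  have c1: "2 * cosh t - 1 > 0" for t :: real
    using cosh_real_ge_1[of t] by linarith
  have sq: "sinh t ^ 2 = cosh t ^ 2 - 1" for t :: real
    using cosh_square_eq[of t] by simp
  have dh: "(h has_real_derivative h' t) (at t)" for t
  proof -
    have "(h has_real_derivative (1 - ((cosh t * cosh t + sinh t * sinh t) * (2 * cosh t - 1)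
        - sinh t * cosh t * (2 * sinh t)) / (2 * cosh t - 1)^2)) (at t)"
      unfolding h_def using c1[of t]
      by (auto intro!: derivative_eq_intros simp: power2_eq_square)
    also have "1 - ((cosh t * cosh t + sinh t * sinh t) * (2 * cosh t - 1)
        - sinh t * cosh t * (2 * sinh t)) / (2 * cosh t - 1)^2
       = 1 - ((cosh t ^ 2 + sinh t ^ 2) * (2 * cosh t - 1)
        - 2 * cosh t * sinh t ^ 2) / (2 * cosh t - 1)^2"
      by (simp add: power2_eq_square algebra_simps)
    also have "\<dots> = ((2 * cosh t - 1)^2 - ((cosh t ^ 2 + sinh t ^ 2) * (2 * cosh t - 1)
        - 2 * cosh t * sinh t ^ 2)) / (2 * cosh t - 1)^2"
      using c1[of t] by (simp add: diff_divide_distrib)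
    also have "\<dots> = h' t"
      unfolding h'_def sq by (rule arg_cong2[where f="(/)"]) (simp_all add: algebra_simps power2_eq_square)
    finally show ?thesis .
  qed
  have df: "(f has_real_derivative f' t) (at t)" for t
  proof -
    have "(f has_real_derivative (tanh t + t * (1 - tanh t ^ 2) - 2 * sinh t / (2 * cosh t - 1))) (at t)"
      unfolding f_def using c1[of t] by (auto intro!: derivative_eq_intros)
    also have "1 - tanh t ^ 2 = 1 / cosh t ^ 2"
      by (simp add: tanh_def power_divide sq field_simps)
    also have "tanh t + t * (1 / cosh t ^ 2) - 2 * sinh t / (2 * cosh t - 1) = f' t"
      unfolding f'_def h_def tanh_def using c1[of t]
      by (simp add: divide_simps) (simp add: algebra_simps power2_eq_square)
    finally show ?thesis .
  qed
  have cgt: "cosh t > 1" if "t > 0" for t :: real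
    using cosh_real_strict_mono[of 0 t] that by simp
  \<comment> \<open>For positive \<open>t\<close> the sign of \<open>h'\<close> is that of
    \<open>2 - cosh t\<close>, and \<open>cosh\<close> is increasing there.\<close>
  have "neg_persists h'"
    unfolding neg_persists_def
  proof (intro allI impI)
    fix t u :: real assume tu: "t > 0" "t < u" "h' t \<le> 0"
    have "\<not> cosh t < 2"
    proof
      assume "cosh t < 2"
      then have "h' t > 0"
        unfolding h'_def using cgt[OF tu(1)] c1[of t] by simp
      then show False using tu by simp
    qed
    then have "cosh u > 2"
      using cosh_real_strict_mono[of t u] tu by linarith
    then show "h' u < 0"
      unfolding h'_def using c1[of u]
      by (intro divide_neg_pos mult_pos_neg) auto
  qed
  moreover have "(h \<longlongrightarrow> 0) (at_right 0)"
  proof -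
    have "isCont h 0" using dh[of 0] by (rule DERIV_isCont)
    then have "(h \<longlongrightarrow> h 0) (at 0)" by (simp add: isCont_def)
    then show ?thesis
      by (auto simp: h_def intro: tendsto_mono[OF at_le])
  qed
  ultimately have nh: "neg_persists h"
    using neg_persists_antiderivative[of h h'] dh by blast
  have "neg_persists f'"
    unfolding neg_persists_def
  proof (intro allI impI)
    fix t u :: real assume tu: "t > 0" "t < u" "f' t \<le> 0"
    then have "h t \<le> 0"
      by (simp add: f'_def divide_le_0_iff)
    then have "h u < 0" using nh tu by (auto simp: neg_persists_def)
    then show "f' u < 0"
      by (simp add: f'_def divide_less_0_iff)
  qed
  moreover have "(f \<longlongrightarrow> 0) (at_right 0)"
  proof -
    have "isCont f 0" using df[of 0] by (rule DERIV_isCont)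
    then have "(f \<longlongrightarrow> f 0) (at 0)" by (simp add: isCont_def)
    then show ?thesis
      by (auto simp: f_def intro: tendsto_mono[OF at_le])
  qed
  \<comment> \<open>Both terms of \<open>f\<close> are \<open>t + o(1)\<close>.\<close>
  moreover have "(f \<longlongrightarrow> 0) at_top"
    unfolding f_def tanh_def sinh_field_def cosh_field_def by real_asymp
  ultimately have "f t > 0"
    using pos_if_limits_zero[of f f' t] df assms by blast
  then have "ln (2 * cosh t - 1) < t * tanh t"
    by (simp add: f_def)
  then have "exp (ln (2 * cosh t - 1)) < exp (t * tanh t)"
    by simp
  then show ?thesis
    using c1[of t] by simp
qed


section \<open>The hyperbolic inequality for r different from 1\<close>

text \<open>This is the claim divided by \<open>2 * exp m\<close>: the right side is half of
  \<open>exp (w + r * w) + exp (w - r * w)\<close>.\<close>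

lemma cosh_less_exp_times_cosh:
  fixes r t :: real
  assumes r: "r > 0" "r \<noteq> 1" and t: "t > 0"
  defines "w \<equiv> (\<lambda>t. (ln (cosh (r * t)) - ln (cosh t)) / (r\<^sup>2 - 1))"
  shows "cosh t < exp (w t) * cosh (r * w t)"
proof -
  define w' where "w' = (\<lambda>t. (r * tanh (r * t) - tanh t) / (r\<^sup>2 - 1))"
  \<comment> \<open>The divisors make \<open>S1\<close> and \<open>S2\<close> positive for
    \<open>t > 0\<close> on either side of \<open>r = 1\<close>, and give both derivative 1 at
    0.\<close>
  define S1 where "S1 = (\<lambda>t. sinh ((r + 1) * t) / (r + 1))"
  define S2 where "S2 = (\<lambda>t. sinh ((r - 1) * t) / (r - 1))"
  define g where "g = (\<lambda>t. w t + ln (cosh (r * w t)) - ln (cosh t))"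
  define g' where "g' = (\<lambda>t. r / (cosh (r * t) * cosh t) *
    ((S2 t - S1 t * exp (- 2 * (r * w t))) / (1 + exp (- 2 * (r * w t)))))"
  \<comment> \<open>\<open>h\<close> comes from solving \<open>g' t = 0\<close> for \<open>exp (2 * r * w t)\<close>.\<close>
  define h where "h = (\<lambda>t. 2 * r * w t - ln (S1 t / S2 t))"
  \<comment> \<open>The factor \<open>r - 1\<close> in \<open>e\<close> and \<open>k\<close> treats
    \<open>r < 1\<close> and \<open>r > 1\<close> at once: \<open>k\<close> is positive, and
    \<open>e\<close> alone decides the sign of \<open>h'\<close>.\<close>
  define e where "e = (\<lambda>t. (r - 1) * (r * cosh t - cosh (r * t)))"
  define k where "k = (\<lambda>t. (r - 1) * (r * sinh t * cosh (r * t) - sinh (r * t) * cosh t))"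
  define h' where "h' = (\<lambda>t. 2 * k t * (r * cosh t + cosh (r * t)) /
    ((r - 1)\<^sup>2 * (r\<^sup>2 - 1)\<^sup>2 * (cosh t * cosh (r * t) * (S1 t * S2 t))) * e t)"
  have r1: "r - 1 \<noteq> 0" "r + 1 \<noteq> 0" using r by auto
  have r2: "r\<^sup>2 - 1 = (r - 1) * (r + 1)" by (simp add: power2_eq_square algebra_simps)
  have r3: "r\<^sup>2 - 1 \<noteq> 0" using r1 r2 by simp
  have S1_pos: "S1 t > 0" if "t > 0" for t
    unfolding S1_def using sinh_mult_sign[of "r + 1" t] r that by simp
  have S2_pos: "S2 t > 0" if "t > 0" for t
    unfolding S2_def using sinh_mult_sign[of "r - 1" t] r1 that by simp
  have S1_eq: "S1 t = (sinh (r * t) * cosh t + cosh (r * t) * sinh t) / (r + 1)" for t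
    unfolding S1_def by (simp add: ring_distribs sinh_add)
  have S2_eq: "S2 t = (sinh (r * t) * cosh t - cosh (r * t) * sinh t) / (r - 1)" for t
    unfolding S2_def by (simp add: ring_distribs sinh_diff)
  have dw: "(w has_real_derivative w' t) (at t)" for t
    unfolding w_def w'_def using r3
    by (auto intro!: derivative_eq_intros simp: tanh_def mult.commute)
  have w'_eq: "w' t = (r * sinh (r * t) * cosh t - sinh t * cosh (r * t)) /
      ((r\<^sup>2 - 1) * (cosh (r * t) * cosh t))" for t
    unfolding w'_def tanh_def by (simp add: divide_simps)
  have dg: "(g has_real_derivative g' t) (at t)" for t
  proof -
    define v where "v = exp (- 2 * (r * w t))"
    have v: "v > 0" by (simp add: v_def)
    have "(g has_real_derivative w' t * (1 + r * tanh (r * w t)) - tanh t) (at t)"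
      unfolding g_def
      by (auto intro!: derivative_eq_intros dw simp: tanh_def field_simps)
    \<comment> \<open>In terms of \<open>v\<close> the numerator of the derivative is affine, and
      its two coefficients collapse to multiples of \<open>S2\<close> and \<open>S1\<close>.\<close>
    also have "tanh (r * w t) = (1 - v) / (1 + v)"
      by (simp add: tanh_real_altdef v_def)
    also have "w' t * (1 + r * ((1 - v) / (1 + v))) - tanh t =
       (w' t * ((1 + v) + r * (1 - v)) - tanh t * (1 + v)) / (1 + v)"
      using v by (simp add: field_simps)
    also have "w' t * ((1 + v) + r * (1 - v)) - tanh t * (1 + v) =
       (w' t * (r + 1) - tanh t) - v * (w' t * (r - 1) + tanh t)"
      by (simp add: algebra_simps)
    also have "w' t * (r + 1) - tanh t = r / (cosh (r * t) * cosh t) * S2 t"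
      unfolding w'_eq r2 S2_eq tanh_def using r1
      by (simp add: divide_simps) (simp add: algebra_simps)
    also have "w' t * (r - 1) + tanh t = r / (cosh (r * t) * cosh t) * S1 t"
      unfolding w'_eq r2 S1_eq tanh_def using r1
      by (simp add: divide_simps) (simp add: algebra_simps)
    also have "(r / (cosh (r * t) * cosh t) * S2 t - v * (r / (cosh (r * t) * cosh t) * S1 t)) / (1 + v) = g' t"
      unfolding g'_def v_def[symmetric] by (simp add: diff_divide_distrib right_diff_distrib mult_ac)
    finally show ?thesis .
  qed
  have dS1: "(S1 has_real_derivative cosh ((r + 1) * t)) (at t)" for t
    unfolding S1_def using r1 by (auto intro!: derivative_eq_intros)
  have dS2: "(S2 has_real_derivative cosh ((r - 1) * t)) (at t)" for t
    unfolding S2_def using r1 by (auto intro!: derivative_eq_intros)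
  have dh: "(h has_real_derivative h' t) (at t)" if "t > 0" for t
  proof -
    define A B s c where "A = sinh (r * t)" and "B = cosh (r * t)"
      and "s = sinh t" and "c = cosh t"
    note ABsc = A_def[symmetric] B_def[symmetric] s_def[symmetric] c_def[symmetric]
    have pos: "S1 t > 0" "S2 t > 0" using S1_pos S2_pos that by auto
    have nz: "B \<noteq> 0" "c \<noteq> 0" by (simp_all add: B_def c_def)
    have A2: "A\<^sup>2 = B\<^sup>2 - 1" and s2: "s\<^sup>2 = c\<^sup>2 - 1"
      using cosh_square_eq[of "r * t"] cosh_square_eq[of t] by (simp_all add: A_def B_def s_def c_def)
    have S1r: "(r + 1) * S1 t = A * c + B * s" and S2r: "(r - 1) * S2 t = A * c - B * s"
      unfolding S1_eq S2_eq ABsc using r1 by simp_all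
    \<comment> \<open>Removes \<open>S1\<close> and \<open>S2\<close> from the denominator, so that
      the derivative of \<open>h\<close> becomes rational in \<open>A\<close>, \<open>B\<close>,
      \<open>s\<close>, \<open>c\<close>.\<close>
    have prod: "(r\<^sup>2 - 1) * (S1 t * S2 t) = B\<^sup>2 - c\<^sup>2"
    proof -
      have "(r\<^sup>2 - 1) * (S1 t * S2 t) = (A * c + B * s) * (A * c - B * s)"
        by (simp add: r2 mult_ac flip: S1r S2r)
      also have "\<dots> = A\<^sup>2 * c\<^sup>2 - B\<^sup>2 * s\<^sup>2" by (simp add: power2_eq_square algebra_simps)
      also have "\<dots> = B\<^sup>2 - c\<^sup>2" unfolding A2 s2 by (simp add: algebra_simps)
      finally show ?thesis .
    qed
    have Bc: "B\<^sup>2 - c\<^sup>2 \<noteq> 0" using prod r3 pos by (metis less_numeral_extra(3) mult_eq_0_iff)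
    have "(h has_real_derivative (2 * r * w' t - (cosh ((r + 1) * t) * S2 t - S1 t * cosh ((r - 1) * t)) / (S2 t * S1 t))) (at t)"
      unfolding h_def using pos
      by (auto intro!: derivative_eq_intros dw dS1 dS2 simp: field_simps)
    also have "cosh ((r + 1) * t) = B * c + A * s"
      by (simp add: ring_distribs cosh_add A_def B_def s_def c_def)
    also have "cosh ((r - 1) * t) = B * c - A * s"
      by (simp add: ring_distribs cosh_diff A_def B_def s_def c_def)
    also have "((B * c + A * s) * S2 t - S1 t * (B * c - A * s)) / (S2 t * S1 t)
      = ((r\<^sup>2 - 1) * ((B * c + A * s) * S2 t - S1 t * (B * c - A * s))) / (B\<^sup>2 - c\<^sup>2)"
      using r3 by (simp add: prod[symmetric] mult.commute)
    also have "(r\<^sup>2 - 1) * ((B * c + A * s) * S2 t - S1 t * (B * c - A * s))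
      = (r + 1) * (B * c + A * s) * (A * c - B * s) - (r - 1) * (B * c - A * s) * (A * c + B * s)"
      unfolding r2 S1r[symmetric] S2r[symmetric] by (simp add: algebra_simps)
    also have "\<dots> = 2 * A * B * (c\<^sup>2 - s\<^sup>2) - 2 * r * c * s * (B\<^sup>2 - A\<^sup>2)"
      by (simp add: power2_eq_square algebra_simps)
    also have "\<dots> = 2 * (A * B - r * c * s)"
      unfolding A2 s2 by (simp add: algebra_simps)
    also have "2 * r * w' t - 2 * (A * B - r * c * s) / (B\<^sup>2 - c\<^sup>2) =
       2 * (r * (r * A * c - s * B) * (B\<^sup>2 - c\<^sup>2) - (r\<^sup>2 - 1) * (B * c) * (A * B - r * c * s))
         / ((r\<^sup>2 - 1) * (B * c) * (B\<^sup>2 - c\<^sup>2))"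
      unfolding w'_eq ABsc using r3 nz Bc by (simp add: divide_simps)
    \<comment> \<open>The decisive factorization: times \<open>r - 1\<close>, the first factor is
      \<open>k t\<close> and the last is \<open>e t\<close>; the middle one is positive.\<close>
    also have "r * (r * A * c - s * B) * (B\<^sup>2 - c\<^sup>2) - (r\<^sup>2 - 1) * (B * c) * (A * B - r * c * s)
       = (r * s * B - A * c) * ((r * c + B) * (r * c - B))"
      by (simp add: power2_eq_square algebra_simps)
    also have "2 * ((r * s * B - A * c) * ((r * c + B) * (r * c - B))) / ((r\<^sup>2 - 1) * (B * c) * (B\<^sup>2 - c\<^sup>2)) = h' t"
      unfolding h'_def k_def e_def ABsc prod[symmetric] using r1 r3 nz pos
      by (simp add: divide_simps) (simp add: power2_eq_square algebra_simps)
    finally show ?thesis .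
  qed
  have e_less: "e u < e t" if "0 < t" "t < u" for t u
  proof (rule DERIV_neg_imp_decreasing[OF that(2)])
    fix x assume x: "t \<le> x" "x \<le> u"
    then have "x > 0" using that by simp
    have "(e has_real_derivative (r - 1) * r * (sinh x - sinh (r * x))) (at x)"
      unfolding e_def by (auto intro!: derivative_eq_intros simp: algebra_simps)
    \<comment> \<open>By monotonicity of \<open>sinh\<close>, the difference has the sign of
      \<open>1 - r\<close>.\<close>
    moreover have "(r - 1) * (sinh x - sinh (r * x)) < 0"
      using r \<open>x > 0\<close> by (cases "r > 1") (auto simp: mult_less_0_iff)
    then have "(r - 1) * r * (sinh x - sinh (r * x)) < 0"
      using r by (metis mult.assoc mult.commute mult_pos_neg)
    ultimately show "\<exists>y. (e has_real_derivative y) (at x) \<and> y < 0" by blast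
  qed
  \<comment> \<open>\<open>k\<close> vanishes at 0, and its derivative contains \<open>r - 1\<close>
    squared, hence is positive.\<close>
  have k_pos: "k t > 0" if "t > 0" for t
  proof -
    have "k 0 < k t"
    proof (rule DERIV_pos_imp_increasing_open[OF that])
      fix x assume x: "0 < x" "x < t"
      have "(k has_real_derivative (r - 1) * ((r\<^sup>2 - 1) * (sinh x * sinh (r * x)))) (at x)"
        unfolding k_def by (auto intro!: derivative_eq_intros simp: algebra_simps power2_eq_square)
      moreover have "(r - 1) * ((r\<^sup>2 - 1) * (sinh x * sinh (r * x))) = (r - 1)\<^sup>2 * (r + 1) * (sinh x * sinh (r * x))"
        unfolding r2 by (simp add: power2_eq_square)
      moreover have "\<dots> > 0"
        using r r1 x by (intro mult_pos_pos) auto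
      ultimately show "\<exists>y. (k has_real_derivative y) (at x) \<and> y > 0" by metis
    next
      show "continuous_on {0..t} k"
        unfolding k_def by (intro continuous_intros)
    qed
    then show ?thesis by (simp add: k_def)
  qed
  have "neg_persists h'"
    unfolding neg_persists_def
  proof (intro allI impI)
    fix t u :: real assume tu: "t > 0" "t < u" "h' t \<le> 0"
    have pos: "2 * k t * (r * cosh t + cosh (r * t)) /
      ((r - 1)\<^sup>2 * (r\<^sup>2 - 1)\<^sup>2 * (cosh t * cosh (r * t) * (S1 t * S2 t))) > 0" if "t > 0" for t
      using k_pos[OF that] S1_pos[OF that] S2_pos[OF that] r r1 r3
      by (intro divide_pos_pos mult_pos_pos add_pos_pos) auto
    have "e t \<le> 0"
      using tu(3) pos[OF tu(1)] unfolding h'_def by (smt (verit) mult_pos_pos)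
    then have "e u < 0" using e_less[OF tu(1,2)] by linarith
    then show "h' u < 0"
      unfolding h'_def using pos[of u] tu by (intro mult_pos_neg) auto
  qed
  moreover have w0: "(w \<longlongrightarrow> 0) (at_right 0)"
  proof -
    have "(w \<longlongrightarrow> w 0) (at 0)" using DERIV_isCont[OF dw[of 0]] by (simp add: isCont_def)
    then show ?thesis
      by (auto simp: w_def intro: tendsto_mono[OF at_le])
  qed
  moreover have "(h \<longlongrightarrow> 0) (at_right 0)"
  proof -
    have "((\<lambda>t. S1 t / t) \<longlongrightarrow> 1) (at 0)" "((\<lambda>t. S2 t / t) \<longlongrightarrow> 1) (at 0)"
      using dS1[of 0] dS2[of 0] by (auto simp: has_field_derivative_iff S1_def S2_def)
    then have "((\<lambda>t. ln ((S1 t / t) / (S2 t / t))) \<longlongrightarrow> ln (1 / 1)) (at 0)"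
      by (intro tendsto_intros) auto
    then have "((\<lambda>t. ln ((S1 t / t) / (S2 t / t))) \<longlongrightarrow> 0) (at_right 0)"
      by (auto intro: tendsto_mono[OF at_le])
    moreover have "eventually (\<lambda>t. ln ((S1 t / t) / (S2 t / t)) = ln (S1 t / S2 t)) (at_right 0)"
      using eventually_at_right_less[of 0] by eventually_elim simp
    ultimately have "((\<lambda>t. ln (S1 t / S2 t)) \<longlongrightarrow> 0) (at_right 0)"
      by (rule Lim_transform_eventually)
    then have "(h \<longlongrightarrow> 2 * r * 0 - 0) (at_right 0)"
      unfolding h_def using w0 by (intro tendsto_intros)
    then show ?thesis by simp
  qed
  ultimately have nh: "neg_persists h"
    using neg_persists_antiderivative[of h h'] dh by blast
  \<comment> \<open>Up to a positive factor \<open>g' t\<close> is \<open>S2 t - S1 t * v\<close>;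
    \<open>h t\<close> compares the logarithms of the same two terms.\<close>
  have g'_less_iff: "(g' t < 0 \<longleftrightarrow> h t < 0) \<and> (g' t \<le> 0 \<longleftrightarrow> h t \<le> 0)" if "t > 0" for t
  proof -
    define v where "v = exp (- 2 * (r * w t))"
    have v: "v > 0" by (simp add: v_def)
    have pos: "S1 t > 0" "S2 t > 0" using S1_pos S2_pos that by auto
    have hln: "h t = ln (S2 t) - ln (S1 t * v)"
      unfolding h_def using pos v by (simp add: ln_div ln_mult v_def)
    have g'_alt: "g' t = r / (cosh (r * t) * cosh t * (1 + v)) * (S2 t - S1 t * v)"
      unfolding g'_def v_def[symmetric] by simp
    define q where "q = r / (cosh (r * t) * cosh t * (1 + v))"
    have "q > 0"
      unfolding q_def using r v by simp
    then have "(g' t < 0 \<longleftrightarrow> S2 t < S1 t * v) \<and> (g' t \<le> 0 \<longleftrightarrow> S2 t \<le> S1 t * v)"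
      unfolding g'_alt q_def[symmetric] by (simp add: mult_less_0_iff mult_le_0_iff)
    then show ?thesis unfolding hln using pos v by simp
  qed
  have "neg_persists g'"
    unfolding neg_persists_def using g'_less_iff neg_persistsD[OF nh] by (meson less_trans)
  moreover have "(g \<longlongrightarrow> 0) (at_right 0)"
  proof -
    have "(g \<longlongrightarrow> g 0) (at 0)" using DERIV_isCont[OF dg[of 0]] by (simp add: isCont_def)
    then show ?thesis
      by (auto simp: g_def w_def intro: tendsto_mono[OF at_le])
  qed
  moreover have "(g \<longlongrightarrow> 0) at_top"
  proof -
    \<comment> \<open>Splitting off the linear part of \<open>ln (cosh x)\<close> gives \<open>(r + 1) * w t = t + o(1)\<close>.\<close>
    define l where "l = (\<lambda>x::real. ln (1 + exp (- 2 * x)))"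
    have ln_cosh: "ln (cosh x) = x - ln 2 + l x" for x :: real
    proof -
      have "cosh x = exp x * (1 + exp (- 2 * x)) / 2"
        by (simp add: cosh_field_def algebra_simps flip: exp_add)
      also have "ln \<dots> = x - ln 2 + l x"
        using add_pos_pos[OF zero_less_one exp_gt_zero[of "- 2 * x"]]
        by (simp add: l_def ln_mult ln_div del: mult_minus_left)
      finally show ?thesis .
    qed
    have l0: "(l \<longlongrightarrow> 0) at_top" unfolding l_def by real_asymp
    have rt: "filterlim (\<lambda>t. r * t) at_top at_top"
      using r by (simp add: filterlim_tendsto_pos_mult_at_top[OF tendsto_const _ filterlim_ident])
    have lr: "((\<lambda>t. l (r * t)) \<longlongrightarrow> 0) at_top"
      by (rule filterlim_compose[OF l0 rt])
    define d where "d = (\<lambda>t. (l (r * t) - l t) / (r - 1))"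
    have d: "(r + 1) * w t = t + d t" for t
      unfolding w_def d_def ln_cosh r2 using r1
      by (simp add: divide_simps) (simp add: algebra_simps)
    have "(d \<longlongrightarrow> (0 - 0) / (r - 1)) at_top"
      unfolding d_def using r1 by (intro tendsto_intros l0 lr)
    then have d0: "(d \<longlongrightarrow> 0) at_top" by simp
    \<comment> \<open>Needed for \<open>r * w t\<close> to tend to infinity, so that
      \<open>l (r * w t)\<close> vanishes in the limit.\<close>
    have "filterlim (\<lambda>t. d t + t) at_top at_top"
      by (rule filterlim_tendsto_add_at_top[OF d0 filterlim_ident])
    then have "filterlim (\<lambda>t. (r / (r + 1)) * (d t + t)) at_top at_top"
      using r by (intro filterlim_tendsto_pos_mult_at_top[OF tendsto_const]) auto
    moreover have "(r / (r + 1)) * (d t + t) = r * w t" for t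
      using d[of t] r1 by (simp add: field_simps)
    ultimately have rw: "filterlim (\<lambda>t. r * w t) at_top at_top" by simp
    have "g = (\<lambda>t. d t + l (r * w t) - l t)"
      unfolding g_def ln_cosh using d by (simp add: fun_eq_iff algebra_simps)
    moreover have "((\<lambda>t. d t + l (r * w t) - l t) \<longlongrightarrow> 0 + 0 - 0) at_top"
      by (intro tendsto_intros d0 l0 filterlim_compose[OF l0 rw])
    ultimately show ?thesis by simp
  qed
  ultimately have "g t > 0"
    using pos_if_limits_zero[of g g' t] dg t by blast
  then have "ln (cosh t) < ln (exp (w t) * cosh (r * w t))"
    by (simp add: g_def ln_mult)
  then show ?thesis by simp
qed

section \<open>The means in the coordinates m and t\<close>

text \<open>The base of the power contains \<open>exp ((r - 1) * m)\<close>, so the exponent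
  \<open>1 / (r - 1)\<close> turns it into \<open>exp m\<close>.\<close>

lemma inv_harmonic_mean_exp_exp:
  fixes r m t :: real
  assumes "r \<noteq> 1"
  shows "inv_harmonic_mean r (exp (m - t)) (exp (m + t)) =
    exp m * exp ((ln (cosh (r * t)) - ln (cosh t)) / (r - 1))"
proof -
  have *: "exp (m + t) powr k + exp (m - t) powr k = exp (k * m) * (2 * cosh (k * t))" for k
    by (simp add: powr_def cosh_field_def algebra_simps flip: exp_add)
  have "exp (m + t) + exp (m - t) = exp m * (2 * cosh t)"
    using *[of 1] by simp
  then have "inv_harmonic_mean r (exp (m - t)) (exp (m + t)) =
    (exp (r * m) * (2 * cosh (r * t)) / (exp m * (2 * cosh t))) powr (1 / (r - 1))"
    using assms by (simp add: inv_harmonic_mean_def *)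
  also have "\<dots> = exp (((r - 1) * m + (ln (cosh (r * t)) - ln (cosh t))) / (r - 1))"
    by (simp add: powr_def ln_div ln_mult left_diff_distrib)
  also have "((r - 1) * m + (ln (cosh (r * t)) - ln (cosh t))) / (r - 1)
      = m + (ln (cosh (r * t)) - ln (cosh t)) / (r - 1)"
    using assms by (simp add: add_divide_distrib)
  finally show ?thesis by (simp add: exp_add)
qed

text \<open>The logarithm of this mean is the average of \<open>m + t\<close> and
  \<open>m - t\<close> weighted by their exponentials, and the weights differ by the fraction
  \<open>tanh t\<close> of their sum.\<close>

lemma inv_harmonic_mean_1_exp_exp:
  fixes m t :: real
  shows "inv_harmonic_mean 1 (exp (m - t)) (exp (m + t)) = exp m * exp (t * tanh t)"
proof -
  let ?a = "exp (m - t)" and ?b = "exp (m + t)"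
  have sum: "?a + ?b = exp m * (2 * cosh t)" and diff: "?b - ?a = exp m * (2 * sinh t)"
    by (simp_all add: cosh_field_def sinh_field_def exp_add exp_diff exp_minus field_simps)
  have "inv_harmonic_mean 1 ?a ?b = exp ((?b * (m + t) + ?a * (m - t)) / (?a + ?b))"
    by (simp add: inv_harmonic_mean_def powr_def flip: exp_add)
  also have "?b * (m + t) + ?a * (m - t) = m * (?a + ?b) + t * (?b - ?a)"
    by (simp add: algebra_simps)
  also have "(m * (?a + ?b) + t * (?b - ?a)) / (?a + ?b) = m + t * tanh t"
    unfolding sum diff by (simp add: tanh_def field_simps)
  finally show ?thesis by (simp add: exp_add)
qed

section \<open>Transfer of the hyperbolic inequalities to the means\<close>

theorem theorem2p3:
  fixes r a b :: real
  assumes "r > 0" and "0 < a" and "a < b"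
  shows "inv_harmonic_mean r a b + inv_harmonic_mean (- r) a b > a + b"
proof -
  define m where "m = (ln a + ln b) / 2"
  define t where "t = (ln b - ln a) / 2"
  have t: "t > 0" using assms by (simp add: t_def)
  have ab: "a = exp (m - t)" "b = exp (m + t)"
    using assms by (simp_all add: m_def t_def field_simps)
  have sum: "a + b = exp m * (2 * cosh t)"
    by (simp add: ab cosh_field_def exp_add exp_diff exp_minus field_simps)
  show ?thesis
  proof (cases "r = 1")
    case True
    \<comment> \<open>Since \<open>cosh\<close> is even, the exponent of the mean at -1 vanishes,
      leaving the geometric mean \<open>exp m\<close>.\<close>
    have "inv_harmonic_mean r a b + inv_harmonic_mean (- r) a b = exp m * (exp (t * tanh t) + 1)"
      unfolding True ab inv_harmonic_mean_1_exp_exp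
      by (simp add: inv_harmonic_mean_exp_exp algebra_simps)
    then show ?thesis
      unfolding sum using two_cosh_minus_1_less[OF t] by simp
  next
    case False
    define w where "w = (ln (cosh (r * t)) - ln (cosh t)) / (r\<^sup>2 - 1)"
    have r2: "r\<^sup>2 - 1 = (r - 1) * (r + 1)" by (simp add: power2_eq_square algebra_simps)
    \<comment> \<open>Evenness of \<open>cosh\<close> gives both exponents the same numerator,
      \<open>(r - 1) * (r + 1) * w\<close>.\<close>
    have "(ln (cosh (r * t)) - ln (cosh t)) / (r - 1) = w + r * w"
      and "(ln (cosh (- r * t)) - ln (cosh t)) / (- r - 1) = w - r * w"
      unfolding w_def r2 using assms False by (simp_all add: divide_simps) (simp_all add: algebra_simps)
    then have "inv_harmonic_mean r a b + inv_harmonic_mean (- r) a b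
        = exp m * (exp (w + r * w) + exp (w - r * w))"
      using assms False by (simp add: ab inv_harmonic_mean_exp_exp algebra_simps)
    also have "exp (w + r * w) + exp (w - r * w) = 2 * (exp w * cosh (r * w))"
      by (simp add: cosh_field_def exp_add exp_diff exp_minus field_simps)
    finally show ?thesis
      unfolding sum using cosh_less_exp_times_cosh[OF assms(1) False t] by (simp add: w_def)
  qed
qed

end
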